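(* Let $G^\sigma$ be an oriented graph with $n$ vertices and $m$ arcs, let $\lambda_1,\dots,\lambda_n$ be the eigenvalues of its skew adjacency matrix $S(G^\sigma)$, and let $I_S^1(G^\sigma)$, $I_\alpha^2(G^\sigma)$, $I_\alpha^3(G^\sigma)$ be the generalized graph entropies formed from $\lambda_1,\dots,\lambda_n$. Then for $\alpha\ne1$: (i) $I_S^1(G^\sigma)=1-\frac{2m}{SE^2(G^\sigma)}$; (ii) $I_\alpha^2(G^\sigma)=\frac{1}{1-\alpha}\log\frac{M_\alpha^*}{SE^\alpha(G^\sigma)}$; (iii) $I_\alpha^3(G^\sigma)=\frac{1}{2^{1-\alpha}-1}\left(\frac{M_\alpha^*}{SE^\alpha(G^\sigma)}-1\right)$, where $SE(G^\sigma)$ is the skew energy of $G^\sigma$, $SE^\alpha(G^\sigma)=(SE(G^\sigma))^\alpha$, and $M_\alpha^*=\sum_{i=1}^n|\lambda_i|^\alpha$.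
   Context: $G$ is a simple undirected graph with vertices $v_1,\dots,v_n$, and $G^\sigma$ is an oriented graph of $G$ with the orientation $\sigma$ (each edge receives one direction). The skew adjacency matrix is the $n\times n$ matrix $S(G^\sigma)=[s_{ij}]$ with $s_{ij}=1$ and $s_{ji}=-1$ if $\langle v_i,v_j\rangle$ is an arc of $G^\sigma$, and $s_{ij}=s_{ji}=0$ if there is no arc between $v_i$ and $v_j$. The skew energy is $SE(G^\sigma)=\sum_{i=1}^n|\lambda_i|$. For complex numbers $\mu_1,\dots,\mu_n$ (listed with multiplicity), put $p_i=|\mu_i|/\sum_{j=1}^n|\mu_j|$. The generalized graph entropies formed from $\mu_1,\dots,\mu_n$ are $I^1=\sum_{i=1}^n p_i(1-p_i)$, $\quad I^2_\alpha=\frac{1}{1-\alpha}\log\left(\sum_{i=1}^n p_i^\alpha\right)$, $\quad I^3_\alpha=\frac{\sum_{i=1}^n p_i^\alpha-1}{2^{1-\alpha}-1}$ for $\alpha\ne1$, where $\log$ is the logarithm to a fixed base. The subscript on $I^1$ names the matrix used. *)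

theory Defs
  imports
    Complex_Main
    "HOL-Computational_Algebra.Fundamental_Theorem_Algebra"
    "Graph_Theory.Pair_Digraph"
    "Jordan_Normal_Form.Char_Poly"
begin

text \<open>
  A simple undirected graph is a \<^locale>\<open>pair_graph\<close>: a finite loop-free digraph in which every
  edge is represented by its two opposite arcs. An orientation keeps exactly one of them.
\<close>
definition is_orientation :: "'v pair_pre_digraph \<Rightarrow> 'v pair_pre_digraph \<Rightarrow> bool" where
  "is_orientation G D \<longleftrightarrow>
     pverts D = pverts G \<and> parcs D \<subseteq> parcs G \<and>
     (\<forall>(u, v) \<in> parcs G. (u, v) \<in> parcs D \<longleftrightarrow> (v, u) \<notin> parcs D)"

text \<open>
  The list \<open>vs\<close> enumerates the vertices. The entries are 0, 1 and -1, but the matrix is taken over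
  the complex numbers because its eigenvalues are not real in general.
\<close>
definition skew_adjacency_matrix :: "'v list \<Rightarrow> 'v pair_pre_digraph \<Rightarrow> complex mat" where
  "skew_adjacency_matrix vs D =
     mat (length vs) (length vs) (\<lambda>(i, j).
       if (vs ! i, vs ! j) \<in> parcs D then 1
       else if (vs ! j, vs ! i) \<in> parcs D then -1
       else 0)"

definition eigenvalue_mset :: "complex mat \<Rightarrow> complex multiset" where
  "eigenvalue_mset A = proots (char_poly A)"

definition skew_energy :: "'v list \<Rightarrow> 'v pair_pre_digraph \<Rightarrow> real" where
  "skew_energy vs D = (\<Sum>x\<in>#eigenvalue_mset (skew_adjacency_matrix vs D). cmod x)"

definition weights :: "complex list \<Rightarrow> real list" where
  "weights \<mu>s = map (\<lambda>x. cmod x / (\<Sum>y\<leftarrow>\<mu>s. cmod y)) \<mu>s"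

definition entropy1 :: "complex list \<Rightarrow> real" where
  "entropy1 \<mu>s = (\<Sum>p\<leftarrow>weights \<mu>s. p * (1 - p))"

text \<open>
  Since \<open>0 powr \<alpha> = 0\<close> for every \<open>\<alpha>\<close>, zero values contribute nothing to the power sums below;
  this matters only for \<open>\<alpha> \<le> 0\<close>. The parameter \<open>b\<close> is the base of the logarithm.
\<close>
definition entropy2 :: "real \<Rightarrow> real \<Rightarrow> complex list \<Rightarrow> real" where
  "entropy2 b \<alpha> \<mu>s = 1 / (1 - \<alpha>) * log b (\<Sum>p\<leftarrow>weights \<mu>s. p powr \<alpha>)"

definition entropy3 :: "real \<Rightarrow> complex list \<Rightarrow> real" where
  "entropy3 \<alpha> \<mu>s = ((\<Sum>p\<leftarrow>weights \<mu>s. p powr \<alpha>) - 1) / (2 powr (1 - \<alpha>) - 1)"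

definition abs_power_sum :: "real \<Rightarrow> complex list \<Rightarrow> real" where
  "abs_power_sum \<alpha> \<mu>s = (\<Sum>x\<leftarrow>\<mu>s. cmod x powr \<alpha>)"

end

theory Submission
  imports Defs "Jordan_Normal_Form.Schur_Decomposition"
begin

text \<open>
  The second and third identities only say that the weights are the numbers \<open>|\<lambda>|\<close> divided
  by their sum, the skew energy, so that a power sum of the weights is a quotient of power sums.
  The first identity is \<open>\<Sum>p - \<Sum>p\<^sup>2\<close> with \<open>\<Sum>p = 1\<close>, and it needs the fact that
  \<open>\<Sum>|\<lambda>|\<^sup>2 = 2m\<close>.

  This fact is a trace computation. Over the complex numbers a matrix \<open>A\<close> is similar to an upper
  triangular one with the eigenvalues on the diagonal, so the trace of \<open>A\<^sup>2\<close> is \<open>\<Sum>\<lambda>\<^sup>2\<close>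
  (\<open>trace_square_eq_sum_eigenvalues\<close>). A skew adjacency matrix is skew-Hermitian. Hence its
  eigenvalues are purely imaginary (\<open>skew_hermitian_eigenvalue_imaginary\<close>), which turns
  \<open>\<lambda>\<^sup>2\<close> into \<open>-|\<lambda>|\<^sup>2\<close>, and the trace of its square is minus the sum of the
  squared moduli of its entries. Together, the squared moduli of the eigenvalues and of the entries
  have the same sum (\<open>skew_hermitian_sum_cmod_eigenvalues\<close>). Each arc contributes two entries of
  modulus one, which gives \<open>2m\<close>. As \<open>m > 0\<close>, some eigenvalue is nonzero and the skew energy
  is positive, so that the weights do sum to one.
\<close>

definition mat_trace :: "'a :: comm_monoid_add mat \<Rightarrow> 'a" where
  "mat_trace A = (\<Sum>i<dim_row A. A $$ (i, i))"

lemma mat_trace_mult: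
  fixes A B :: "'a :: semiring_0 mat"
  assumes "A \<in> carrier_mat n k" "B \<in> carrier_mat k n"
  shows "mat_trace (A * B) = (\<Sum>i<n. \<Sum>j<k. A $$ (i, j) * B $$ (j, i))"
  using assms by (auto simp: mat_trace_def scalar_prod_def atLeast0LessThan intro!: sum.cong)

lemma mat_trace_mult_commute:
  fixes A B :: "'a :: comm_semiring_0 mat"
  assumes "A \<in> carrier_mat n k" "B \<in> carrier_mat k n"
  shows "mat_trace (A * B) = mat_trace (B * A)"
  unfolding mat_trace_mult[OF assms] mat_trace_mult[OF assms(2,1)]
  by (subst sum.swap) (simp add: mult.commute)

lemma mat_trace_similar:
  fixes A B :: "'a :: comm_ring_1 mat"
  assumes "similar_mat_wit A B P Q"
  shows "mat_trace A = mat_trace B"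
proof -
  obtain n where c: "Q * P = 1\<^sub>m n" "A = P * B * Q" "B \<in> carrier_mat n n"
      "P \<in> carrier_mat n n" "Q \<in> carrier_mat n n"
    using similar_mat_witD[OF refl assms] by blast
  have "mat_trace (P * B * Q) = mat_trace (Q * (P * B))"
    using c by (intro mat_trace_mult_commute[of _ n n]) auto
  also have "Q * (P * B) = Q * P * B"
    using c assoc_mult_mat[of Q n n P n B n] by simp
  finally show ?thesis using c by (simp del: assoc_mult_mat)
qed

lemma trace_square_upper_triangular:
  fixes B :: "'a :: comm_ring_1 mat"
  assumes "B \<in> carrier_mat n n" "upper_triangular B"
  shows "mat_trace (B * B) = (\<Sum>x\<leftarrow>diag_mat B. x\<^sup>2)"
proof -
  have "(\<Sum>j<n. B $$ (i, j) * B $$ (j, i)) = (B $$ (i, i))\<^sup>2" if "i < n" for i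
  proof -
    have "B $$ (i, j) * B $$ (j, i) = (if j = i then (B $$ (i, i))\<^sup>2 else 0)" if "j < n" for j
      \<comment> \<open>Off the diagonal, one of the two mirrored entries lies below it.\<close>
      using upper_triangularD[OF assms(2), of i j] upper_triangularD[OF assms(2), of j i]
        assms(1) \<open>i < n\<close> \<open>j < n\<close>
      by (cases i j rule: linorder_cases) (auto simp: power2_eq_square)
    then show ?thesis using \<open>i < n\<close> by (simp add: sum.delta)
  qed
  then have "mat_trace (B * B) = (\<Sum>i<n. (B $$ (i, i))\<^sup>2)"
    by (simp add: mat_trace_mult[OF assms(1,1)])
  also have "\<dots> = (\<Sum>x\<leftarrow>diag_mat B. x\<^sup>2)"
    using assms(1) by (simp add: diag_mat_def o_def interv_sum_list_conv_sum_set_nat atLeast0LessThan)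
  finally show ?thesis .
qed

lemma proots_prod_linear_factors:
  fixes es :: "'a :: idom list"
  shows "proots (\<Prod>e\<leftarrow>es. [:- e, 1:]) = mset es"
proof (induction es)
  case (Cons e es)
  have "proots [:- e, 1:] = {#e#}"
    by (rule multiset_eqI) (auto simp: order_linear order_0I)
  moreover have "(\<Prod>e\<leftarrow>es. [:- e, 1:]) \<noteq> (0 :: 'a poly)"
    by (auto simp: prod_list_zero_iff)
  ultimately show ?case using Cons proots_mult[of "[:- e, 1:]"]
    by (simp del: mult_pCons_left)
qed simp

text \<open>
  Squaring a similarity between \<open>A\<close> and its Schur form gives one between their squares, and the
  trace does not see the difference.
\<close>
lemma trace_square_eq_sum_eigenvalues:
  assumes "A \<in> carrier_mat n n"
  shows "mat_trace (A * A) = (\<Sum>x\<in>#eigenvalue_mset A. x\<^sup>2)"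
proof -
  obtain es where es: "char_poly A = (\<Prod>e\<leftarrow>es. [:- e, 1:])"
    using char_poly_factorized[OF assms] by blast
  obtain B P Q where "schur_decomposition A es = (B, P, Q)"
    by (cases "schur_decomposition A es") auto
  from schur_decomposition[OF assms es this]
  have sim: "similar_mat_wit A B P Q" and B: "upper_triangular B" "diag_mat B = es"
    by auto
  note c = similar_mat_witD2[OF assms sim]
  have "similar_mat_wit (A ^\<^sub>m 2) (B ^\<^sub>m 2) P Q"
    by (rule similar_mat_wit_pow[OF sim])
  then have "mat_trace (A * A) = mat_trace (B * B)"
    using assms c by (auto dest!: mat_trace_similar simp: numeral_2_eq_2)
  also have "\<dots> = (\<Sum>x\<leftarrow>es. x\<^sup>2)"
    using trace_square_upper_triangular[of B n] c B by simp
  also have "\<dots> = (\<Sum>x\<in>#eigenvalue_mset A. x\<^sup>2)"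
    by (simp add: eigenvalue_mset_def es proots_prod_linear_factors sum_mset_sum_list[symmetric])
  finally show ?thesis .
qed

text \<open>
  For an eigenvector \<open>v\<close>, the quadratic form \<open>v\<^sup>* A v = \<lambda> v\<^sup>* v\<close> equals minus its own
  conjugate, while \<open>v\<^sup>* v\<close> is a nonzero real number.
\<close>
lemma skew_hermitian_eigenvalue_imaginary:
  assumes A: "A \<in> carrier_mat n n"
    and skew: "\<And>i j. i < n \<Longrightarrow> j < n \<Longrightarrow> cnj (A $$ (i, j)) = - A $$ (j, i)"
    and ev: "eigenvalue A l"
  shows "Re l = 0"
proof -
  obtain v where v: "v \<in> carrier_vec n" "v \<noteq> 0\<^sub>v n" and Av: "A *\<^sub>v v = l \<cdot>\<^sub>v v"
    using ev A by (auto simp: eigenvalue_def eigenvector_def)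
  have row: "(\<Sum>j<n. A $$ (i, j) * v $ j) = l * v $ i" if "i < n" for i
    using arg_cong[OF Av, of "\<lambda>w. w $ i"] that A v
    by (simp add: scalar_prod_def atLeast0LessThan)
  define N where "N = (\<Sum>i<n. (cmod (v $ i))\<^sup>2)"
  define q where "q = (\<Sum>i<n. \<Sum>j<n. cnj (v $ i) * (A $$ (i, j) * v $ j))"
  have "q = (\<Sum>i<n. cnj (v $ i) * (l * v $ i))"
    unfolding q_def by (intro sum.cong refl) (simp add: sum_distrib_left[symmetric] row)
  also have "\<dots> = l * of_real N"
    unfolding N_def of_real_sum sum_distrib_left
    by (intro sum.cong refl) (simp only: complex_norm_square mult_ac)
  finally have q: "q = l * of_real N" .
  have "cnj q = (\<Sum>i<n. \<Sum>j<n. - (cnj (v $ j) * (A $$ (j, i) * v $ i)))"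
    unfolding q_def cnj_sum by (intro sum.cong refl) (simp add: skew mult_ac)
  also have "\<dots> = - q"
    unfolding q_def by (subst sum.swap) (simp add: sum_negf)
  finally have "Re (cnj q) = Re (- q)" by (rule arg_cong)
  then have "Re l * N = 0" by (simp add: q)
  moreover have "N \<noteq> 0"
  proof
    assume "N = 0"
    then have "\<forall>i<n. v $ i = 0"
      by (simp add: N_def sum_nonneg_eq_0_iff)
    then have "v = 0\<^sub>v n" using v by (intro eq_vecI) auto
    then show False using v by simp
  qed
  ultimately show ?thesis by simp
qed

text \<open>
  Both sides are the trace of \<open>- A\<^sup>2\<close>. The equality holds for normal matrices in general; for
  skew-Hermitian ones it follows without a unitary triangularisation, because
  \<open>|\<lambda>|\<^sup>2\<close> is then the polynomial \<open>- \<lambda>\<^sup>2\<close> in \<open>\<lambda>\<close>.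
\<close>
lemma skew_hermitian_sum_cmod_eigenvalues:
  assumes A: "A \<in> carrier_mat n n"
    and skew: "\<And>i j. i < n \<Longrightarrow> j < n \<Longrightarrow> cnj (A $$ (i, j)) = - A $$ (j, i)"
  shows "(\<Sum>x\<in>#eigenvalue_mset A. (cmod x)\<^sup>2) = (\<Sum>i<n. \<Sum>j<n. (cmod (A $$ (i, j)))\<^sup>2)"
proof -
  have sq: "complex_of_real ((cmod x)\<^sup>2) = - x\<^sup>2" if "x \<in># eigenvalue_mset A" for x
  proof -
    have "char_poly A \<noteq> 0" using degree_monic_char_poly[OF A] by auto
    then have "eigenvalue A x"
      using that by (simp add: eigenvalue_mset_def eigenvalue_root_char_poly[OF A])
    then have "Re x = 0" using skew_hermitian_eigenvalue_imaginary[OF A skew] by blast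
    then have "cnj x = - x" by (simp add: complex_eq_iff)
    then show ?thesis by (simp only: complex_norm_square) (simp add: power2_eq_square)
  qed
  have "complex_of_real (\<Sum>x\<in>#eigenvalue_mset A. (cmod x)\<^sup>2)
      = (\<Sum>x\<in>#eigenvalue_mset A. complex_of_real ((cmod x)\<^sup>2))"
    by (simp only: of_real_hom.hom_sum_mset image_mset.compositionality o_def)
  also have "\<dots> = (\<Sum>x\<in>#eigenvalue_mset A. - x\<^sup>2)"
    using sq by (intro arg_cong[where f = sum_mset] image_mset_cong) blast
  also have "\<dots> = - mat_trace (A * A)"
    unfolding trace_square_eq_sum_eigenvalues[OF A]
    using sum_mset_distrib_left[of "- 1" "\<lambda>x. x\<^sup>2" "eigenvalue_mset A"] by (simp only: mult_minus1)
  also have "\<dots> = (\<Sum>i<n. \<Sum>j<n. - (A $$ (i, j) * A $$ (j, i)))"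
    by (simp add: mat_trace_mult[OF A A] sum_negf)
  also have "\<dots> = (\<Sum>i<n. \<Sum>j<n. complex_of_real ((cmod (A $$ (i, j)))\<^sup>2))"
    by (intro sum.cong refl) (simp only: complex_norm_square, simp add: skew)
  finally show ?thesis by (simp only: of_real_sum[symmetric] of_real_eq_iff)
qed

text \<open>
  An orientation has no two opposite arcs, so the arcs and their reversals are disjoint sets of
  positions in the matrix, and the nonzero entries are exactly those at these positions.
\<close>
lemma sum_cmod_skew_adjacency_entries:
  assumes G: "pair_graph G" and D: "is_orientation G D"
    and vs: "distinct vs" "set vs = pverts D"
  defines "A \<equiv> skew_adjacency_matrix vs D" and "n \<equiv> length vs"
  shows "(\<Sum>i<n. \<Sum>j<n. (cmod (A $$ (i, j)))\<^sup>2) = 2 * real (card (parcs D))"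
proof -
  interpret pair_graph G by fact
  let ?E = "parcs D"
  have sub: "?E \<subseteq> parcs G" and opp: "\<And>u v. (u, v) \<in> ?E \<Longrightarrow> (v, u) \<notin> ?E"
    using D by (auto simp: is_orientation_def)
  have V: "?E \<subseteq> set vs \<times> set vs"
    using sub D vs in_arcsD1 in_arcsD2 by (force simp: is_orientation_def)
  have fin: "finite ?E" using finite_subset[OF sub] by simp
  have idx: "bij_betw (\<lambda>i. vs ! i) {..<n} (set vs)"
    using vs unfolding n_def by (simp add: bij_betw_nth)
  let ?f = "\<lambda>(u, v). if (u, v) \<in> ?E \<union> ?E\<inverse> then 1 else 0 :: real"
  have "(\<Sum>i<n. \<Sum>j<n. (cmod (A $$ (i, j)))\<^sup>2) = (\<Sum>i<n. \<Sum>j<n. ?f (vs ! i, vs ! j))"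
    by (intro sum.cong refl) (auto simp: A_def n_def skew_adjacency_matrix_def)
  also have "\<dots> = (\<Sum>u\<in>set vs. \<Sum>v\<in>set vs. ?f (u, v))"
    by (simp add: sum.reindex_bij_betw[OF idx, symmetric])
  also have "\<dots> = (\<Sum>e\<in>set vs \<times> set vs. ?f e)"
    by (simp add: sum.cartesian_product)
  also have "\<dots> = (\<Sum>e\<in>?E \<union> ?E\<inverse>. 1)"
    using V by (intro sum.mono_neutral_cong_right) (auto split: if_splits)
  also have "\<dots> = real (card (?E \<union> ?E\<inverse>))" by simp
  also have "card (?E \<union> ?E\<inverse>) = card ?E + card (?E\<inverse>)"
    using fin opp by (intro card_Un_disjoint) auto
  finally show ?thesis by (simp add: card_inverse)
qed

lemma skew_adjacency_matrix_skew_hermitian: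
  assumes "is_orientation G D" "i < length vs" "j < length vs"
  shows "cnj (skew_adjacency_matrix vs D $$ (i, j)) = - skew_adjacency_matrix vs D $$ (j, i)"
  using assms by (auto simp: skew_adjacency_matrix_def is_orientation_def)

lemma sum_cmod_skew_eigenvalues:
  assumes "pair_graph G" "is_orientation G D" "distinct vs" "set vs = pverts D"
  shows "(\<Sum>x\<in>#eigenvalue_mset (skew_adjacency_matrix vs D). (cmod x)\<^sup>2)
    = 2 * real (card (parcs D))"
proof -
  have "skew_adjacency_matrix vs D \<in> carrier_mat (length vs) (length vs)"
    by (simp add: skew_adjacency_matrix_def)
  then show ?thesis
    using skew_hermitian_sum_cmod_eigenvalues skew_adjacency_matrix_skew_hermitian[OF assms(2)]
      sum_cmod_skew_adjacency_entries[OF assms] by metis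
qed

lemma entropy1_eq:
  assumes "(\<Sum>x\<leftarrow>xs. cmod x) \<noteq> 0"
  shows "entropy1 xs = 1 - (\<Sum>x\<leftarrow>xs. (cmod x)\<^sup>2) / (\<Sum>x\<leftarrow>xs. cmod x)\<^sup>2"
proof -
  \<comment> \<open>The normalising sum is generalised to a constant, which the induction can keep fixed.\<close>
  have "(\<Sum>x\<leftarrow>ys. cmod x / S * (1 - cmod x / S))
      = (\<Sum>x\<leftarrow>ys. cmod x) / S - (\<Sum>x\<leftarrow>ys. (cmod x)\<^sup>2) / S\<^sup>2" for ys S
    by (induction ys) (simp_all add: algebra_simps add_divide_distrib power2_eq_square)
  then show ?thesis using assms by (simp add: entropy1_def weights_def o_def)
qed

lemma sum_powr_weights:
  "(\<Sum>p\<leftarrow>weights xs. p powr \<alpha>) = abs_power_sum \<alpha> xs / (\<Sum>x\<leftarrow>xs. cmod x) powr \<alpha>"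
proof -
  have "0 \<le> (\<Sum>x\<leftarrow>xs. cmod x)" by (intro sum_list_nonneg) auto
  moreover have "(\<Sum>x\<leftarrow>ys. (cmod x / S) powr \<alpha>) = (\<Sum>x\<leftarrow>ys. cmod x powr \<alpha>) / S powr \<alpha>"
    if "0 \<le> S" for ys S
    using that by (induction ys) (simp_all add: powr_divide add_divide_distrib)
  ultimately show ?thesis by (simp add: weights_def abs_power_sum_def o_def)
qed

theorem theorem3p9:
  fixes G D :: "'v pair_pre_digraph"
    and vs :: "'v list"
    and n m :: nat
    and ls :: "complex list"
    and \<alpha> b :: real
  assumes "pair_graph G"
    and "is_orientation G D"
    and "distinct vs" and "set vs = pverts D"
    and "n = card (pverts D)" and "m = card (parcs D)"
    and "m > 0"
    and "length ls = n"
    and "mset ls = eigenvalue_mset (skew_adjacency_matrix vs D)"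
    and "b > 0" and "b \<noteq> 1"
    and "\<alpha> \<noteq> 1"
  shows "entropy1 ls = 1 - 2 * real m / (skew_energy vs D)\<^sup>2 \<and>
         entropy2 b \<alpha> ls =
           1 / (1 - \<alpha>) * log b (abs_power_sum \<alpha> ls / skew_energy vs D powr \<alpha>) \<and>
         entropy3 \<alpha> ls =
           1 / (2 powr (1 - \<alpha>) - 1) * (abs_power_sum \<alpha> ls / skew_energy vs D powr \<alpha> - 1)"
proof -
  have SE: "(\<Sum>x\<leftarrow>ls. cmod x) = skew_energy vs D"
    by (simp add: skew_energy_def assms(9)[symmetric] sum_mset_sum_list[symmetric])
  have sq: "(\<Sum>x\<leftarrow>ls. (cmod x)\<^sup>2) = 2 * real m"
    using sum_cmod_skew_eigenvalues[OF assms(1-4)]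
    by (simp add: assms(6) assms(9)[symmetric] sum_mset_sum_list[symmetric])
  have "(\<Sum>x\<leftarrow>ls. cmod x) \<noteq> 0"
  proof
    assume "(\<Sum>x\<leftarrow>ls. cmod x) = 0"
    then have "\<forall>x\<in>set ls. x = 0"
      by (subst (asm) sum_list_nonneg_eq_0_iff) auto
    then have "(\<Sum>x\<leftarrow>ls. (cmod x)\<^sup>2) = (\<Sum>x\<leftarrow>ls. 0)"
      by (intro arg_cong[where f = sum_list] map_cong) auto
    then show False using sq \<open>m > 0\<close> by simp
  qed
  from entropy1_eq[OF this] show ?thesis
    by (simp add: entropy2_def entropy3_def sum_powr_weights SE sq)
qed

end
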